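(* Let the stochastic game be as described in the context, and let $\phi:\prod_{i=1}^N[0,u_i^{max}]\to\mathbb{R}$ be concave, continuous and non-negative. Let $C=\sum_{i=1}^N(u_i^{max})^2$. Fix $V>0$, and let $\{\omega(t)\}_{t\ge 0}$ in $\Omega$ and $\{b(t)\}_{t\ge 0}$ in $\mathcal{A}_1\times\cdots\times\mathcal{A}_N$ be arbitrary sequences. Suppose that $\{\alpha(t)\}$ and $\{\gamma(t)\}$ are generated by the general algorithm (described in the context) with this $V$ and with $Q_i(0)=Z_i(0)=0$ for all $i\in\{1,\dots,N\}$. Then for all positive integers $T$ and $K$: $$\frac1{KT}\sum_{\tau=0}^{KT-1}\phi(\gamma(\tau))\ \ge\ \frac1K\sum_{k=0}^{K-1}\psi_T[k]-\frac{TC}{V},$$ where $\psi_T[k]$ is the $T$-slot lookahead value of frame $k$ defined in the context.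
   Context: Game. $N\ge 2$ is an integer (number of players). $\Omega$ and $\mathcal{A}_1,\dots,\mathcal{A}_N$ are arbitrary nonempty sets (event set and action sets). For each $i$, $\hat{u}_i:\mathcal{A}_1\times\cdots\times\mathcal{A}_N\times\Omega\to\mathbb{R}$ is a utility function with $0\le \hat{u}_i(\alpha,\omega)\le u_i^{max}$ for all $(\alpha,\omega)$, where $u_i^{max}<\infty$. It is assumed that for every $\omega\in\Omega$ and all real $\beta_1,\dots,\beta_N$, the supremum of $\sum_{i=1}^N\beta_i\hat{u}_i(\alpha,\omega)$ over $\alpha\in\mathcal{A}_1\times\cdots\times\mathcal{A}_N$ is attained. Sequences. $\omega(t)$ is the event vector and $b(t)=(b_1(t),\dots,b_N(t))$ the vector of baseline actions on round $t\in\{0,1,2,\dots\}$. For an action sequence $\alpha(t)=(\alpha_1(t),\dots,\alpha_N(t))$ define $u_i(t)=\hat{u}_i(\alpha(t),\omega(t))$ and $x_i(t)=\hat{u}_i(b(t),\omega(t))$. General algorithm with parameter $V$. It maintains $Q(t)=(Q_1(t),\dots,Q_N(t))$ and $Z(t)=(Z_1(t),\dots,Z_N(t))$. On every round $t\in\{0,1,2,\dots\}$: (1) choose $\gamma(t)=(\gamma_1(t),\dots,\gamma_N(t))$ as a maximizer of $V\phi(\gamma)-\sum_{i=1}^NZ_i(t)\gamma_i$ over $\gamma\in\prod_{i=1}^N[0,u_i^{max}]$; (2) choose $\alpha(t)$ as a maximizer of $\sum_{i=1}^N\hat{u}_i(\alpha,\omega(t))[Q_i(t)+Z_i(t)]$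 over $\alpha\in\mathcal{A}_1\times\cdots\times\mathcal{A}_N$; (3) update, for each $i$, $Q_i(t+1)=\max[Q_i(t)+x_i(t)-u_i(t),0]$ and $Z_i(t+1)=Z_i(t)+\gamma_i(t)-u_i(t)$. (Ties among maximizers are broken arbitrarily.) $T$-slot lookahead value. For a positive integer $T$ and an integer $k\ge0$, $\psi_T[k]$ is the supremum of $\phi(\gamma_1,\dots,\gamma_N)$ over all choices of $\gamma_i\in[0,u_i^{max}]$ and $\alpha(\tau)\in\mathcal{A}_1\times\cdots\times\mathcal{A}_N$ for $\tau\in\{kT,\dots,(k+1)T-1\}$ such that, for all $i\in\{1,\dots,N\}$, $\gamma_i=\frac1T\sum_{\tau=kT}^{(k+1)T-1}\hat{u}_i(\alpha(\tau),\omega(\tau))$ and $\gamma_i\ge\frac1T\sum_{\tau=kT}^{(k+1)T-1}\hat{u}_i(b(\tau),\omega(\tau))$. *)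

theory Defs
  imports "HOL-Analysis.Analysis"
begin

text \<open>
  Players are the elements of a finite type \<open>'n\<close>, so \<open>N\<close> is \<open>CARD('n)\<close> and the box
  \<open>\<Prod>\<^sub>i [0, umax\<^sub>i]\<close> is \<open>cbox 0 umax\<close> in \<open>real ^ 'n\<close>.  The action sets are arbitrary subsets
  \<open>A i\<close> of one type \<open>'a\<close>; families of unrelated sets are covered by taking \<open>'a\<close> to be
  their disjoint union.
\<close>

definition profiles :: "('n \<Rightarrow> 'a set) \<Rightarrow> ('n \<Rightarrow> 'a) set" where
  "profiles A = (\<Pi> i\<in>UNIV. A i)"

definition stochastic_game ::
  "'w set \<Rightarrow> ('n::finite \<Rightarrow> 'a set) \<Rightarrow> ('n \<Rightarrow> ('n \<Rightarrow> 'a) \<Rightarrow> 'w \<Rightarrow> real) \<Rightarrow> real ^ 'n \<Rightarrow> bool"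
where
  "stochastic_game \<Omega> A u umax \<longleftrightarrow>
     CARD('n) \<ge> 2 \<and> \<Omega> \<noteq> {} \<and> (\<forall>i. A i \<noteq> {}) \<and>
     (\<forall>i. \<forall>\<alpha>\<in>profiles A. \<forall>\<omega>\<in>\<Omega>. 0 \<le> u i \<alpha> \<omega> \<and> u i \<alpha> \<omega> \<le> umax $ i) \<and>
     (\<forall>\<omega>\<in>\<Omega>. \<forall>\<beta> :: 'n \<Rightarrow> real.
        \<exists>\<alpha>. is_arg_max (\<lambda>\<alpha>. \<Sum>i\<in>UNIV. \<beta> i * u i \<alpha> \<omega>) (\<lambda>\<alpha>. \<alpha> \<in> profiles A) \<alpha>)"

text \<open>
  Ties among maximizers may be broken arbitrarily, so the algorithm is a relation on
  trajectories rather than a function.  The initial values of \<open>Q\<close> and \<open>Z\<close> are left open.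
\<close>

definition general_algorithm ::
  "('n::finite \<Rightarrow> 'a set) \<Rightarrow> ('n \<Rightarrow> ('n \<Rightarrow> 'a) \<Rightarrow> 'w \<Rightarrow> real) \<Rightarrow> real ^ 'n \<Rightarrow>
   (real ^ 'n \<Rightarrow> real) \<Rightarrow> real \<Rightarrow> (nat \<Rightarrow> 'w) \<Rightarrow> (nat \<Rightarrow> 'n \<Rightarrow> 'a) \<Rightarrow>
   (nat \<Rightarrow> real ^ 'n) \<Rightarrow> (nat \<Rightarrow> real ^ 'n) \<Rightarrow> (nat \<Rightarrow> real ^ 'n) \<Rightarrow> (nat \<Rightarrow> 'n \<Rightarrow> 'a) \<Rightarrow> bool"
where
  "general_algorithm A u umax \<phi> V \<omega> b Q Z \<gamma> \<alpha> \<longleftrightarrow>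
     (\<forall>t.
        is_arg_max (\<lambda>g. V * \<phi> g - (\<Sum>i\<in>UNIV. Z t $ i * g $ i)) (\<lambda>g. g \<in> cbox 0 umax) (\<gamma> t) \<and>
        is_arg_max (\<lambda>a. \<Sum>i\<in>UNIV. u i a (\<omega> t) * (Q t $ i + Z t $ i))
          (\<lambda>a. a \<in> profiles A) (\<alpha> t) \<and>
        (\<forall>i. Q (Suc t) $ i = max (Q t $ i + u i (b t) (\<omega> t) - u i (\<alpha> t) (\<omega> t)) 0) \<and>
        (\<forall>i. Z (Suc t) $ i = Z t $ i + \<gamma> t $ i - u i (\<alpha> t) (\<omega> t)))"

definition lookahead_feasible ::
  "('n::finite \<Rightarrow> 'a set) \<Rightarrow> ('n \<Rightarrow> ('n \<Rightarrow> 'a) \<Rightarrow> 'w \<Rightarrow> real) \<Rightarrow> real ^ 'n \<Rightarrow>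
   (nat \<Rightarrow> 'w) \<Rightarrow> (nat \<Rightarrow> 'n \<Rightarrow> 'a) \<Rightarrow> nat \<Rightarrow> nat \<Rightarrow> real ^ 'n \<Rightarrow> (nat \<Rightarrow> 'n \<Rightarrow> 'a) \<Rightarrow> bool"
where
  "lookahead_feasible A u umax \<omega> b T k \<gamma> \<alpha> \<longleftrightarrow>
     \<gamma> \<in> cbox 0 umax \<and>
     (\<forall>\<tau>\<in>{k * T..<(k + 1) * T}. \<alpha> \<tau> \<in> profiles A) \<and>
     (\<forall>i. \<gamma> $ i = 1 / real T * (\<Sum>\<tau>\<in>{k * T..<(k + 1) * T}. u i (\<alpha> \<tau>) (\<omega> \<tau>))) \<and>
     (\<forall>i. \<gamma> $ i \<ge> 1 / real T * (\<Sum>\<tau>\<in>{k * T..<(k + 1) * T}. u i (b \<tau>) (\<omega> \<tau>)))"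

text \<open>
  For \<open>T > 0\<close>, baseline profiles \<open>b\<close> and a continuous \<open>\<phi>\<close>, the set below is nonempty
  (\<open>\<alpha> = b\<close> is feasible) and bounded, so the real-valued \<open>Sup\<close> is the true supremum.
\<close>

definition lookahead_value ::
  "('n::finite \<Rightarrow> 'a set) \<Rightarrow> ('n \<Rightarrow> ('n \<Rightarrow> 'a) \<Rightarrow> 'w \<Rightarrow> real) \<Rightarrow> real ^ 'n \<Rightarrow>
   (real ^ 'n \<Rightarrow> real) \<Rightarrow> (nat \<Rightarrow> 'w) \<Rightarrow> (nat \<Rightarrow> 'n \<Rightarrow> 'a) \<Rightarrow> nat \<Rightarrow> nat \<Rightarrow> real"
where
  "lookahead_value A u umax \<phi> \<omega> b T k =
     Sup {\<phi> \<gamma> | \<gamma> \<alpha>. lookahead_feasible A u umax \<omega> b T k \<gamma> \<alpha>}"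

end

theory Submission
  imports Defs
begin

text \<open>
  Drift-plus-penalty.  With \<open>L = (\<Sum>i. Q\<^sub>i\<^sup>2 + Z\<^sub>i\<^sup>2) / 2\<close>, the two maximization steps say that
  \<open>\<gamma> t\<close> and \<open>\<alpha> t\<close> minimize an upper bound on \<open>L (t + 1) - L t - V \<phi> (\<gamma> t)\<close>, so this bound can be
  evaluated at any lookahead-feasible competitor instead.  Over a frame of length \<open>T\<close> the queues move
  by at most \<open>j umax\<^sub>i\<close> in \<open>j\<close> rounds; freezing them at the start of the frame costs
  \<open>T (T - 1) C\<close> in total, and with frozen queues the feasibility constraints make the cross terms
  nonpositive.  The second-order terms cost \<open>T C\<close>, so a frame costs \<open>T\<^sup>2 C\<close>; telescoping \<open>L\<close>
  over \<open>K\<close> frames gives the bound.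
\<close>

text \<open>Truncation at 0 can only shrink the square, and both \<open>x - y\<close> and
  \<open>g - y\<close> lie in \<open>[-m, m]\<close>. Their two half-squares therefore add up to at
  most \<open>m\<^sup>2\<close>; the rest of the expanded squares is linear in \<open>q\<close> and
  \<open>z\<close>.\<close>

lemma quadratic_drift_le:
  fixes q z x y g m :: real
  assumes "0 \<le> x" "x \<le> m" "0 \<le> y" "y \<le> m" "0 \<le> g" "g \<le> m"
  shows "((max (q + x - y) 0)\<^sup>2 + (z + g - y)\<^sup>2) / 2 - (q\<^sup>2 + z\<^sup>2) / 2
           \<le> m\<^sup>2 + q * (x - y) + z * (g - y)"
proof -
  have "(max (q + x - y) 0)\<^sup>2 \<le> (q + x - y)\<^sup>2"
    by (simp add: max_def)
  moreover have "(x - y)\<^sup>2 \<le> m\<^sup>2" "(g - y)\<^sup>2 \<le> m\<^sup>2"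
    using assms by (auto intro!: power2_le_iff_abs_le[THEN iffD2])
  moreover have "((q + x - y)\<^sup>2 + (z + g - y)\<^sup>2) / 2 - (q\<^sup>2 + z\<^sup>2) / 2
      = (x - y)\<^sup>2 / 2 + (g - y)\<^sup>2 / 2 + q * (x - y) + z * (g - y)"
    by (simp add: power2_eq_square field_simps)
  ultimately show ?thesis
    by argo
qed

lemma abs_diff_le_of_increments:
  fixes f :: "nat \<Rightarrow> real"
  assumes "\<And>t. \<bar>f (Suc t) - f t\<bar> \<le> c"
  shows "\<bar>f (s + j) - f s\<bar> \<le> real j * c"
proof (induction j)
  case (Suc j)
  then show ?case
    using assms[of "s + j"] by (simp add: algebra_simps)
qed simp

text \<open>In round \<open>s + j\<close>, replacing \<open>f (s + j)\<close> by \<open>f s\<close>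
  costs at most \<open>j * c\<close> times the bound \<open>c\<close> on \<open>d\<close>; summing
  \<open>j\<close> from 0 to \<open>T - 1\<close> gives the factor \<open>T (T - 1) / 2\<close>.
  Here \<open>f\<close> will be a queue and \<open>d\<close> its drift under a competitor.\<close>

lemma sum_mult_le_frozen:
  fixes f d :: "nat \<Rightarrow> real"
  assumes "\<And>t. \<bar>f (Suc t) - f t\<bar> \<le> c" and "\<And>t. t \<in> {s..<s + T} \<Longrightarrow> \<bar>d t\<bar> \<le> c"
  shows "(\<Sum>t\<in>{s..<s + T}. f t * d t)
           \<le> f s * (\<Sum>t\<in>{s..<s + T}. d t) + real T * (real T - 1) / 2 * c\<^sup>2"
  using assms(2)
proof (induction T)
  case (Suc T)
  have c: "0 \<le> c"
    using assms(1)[of 0] by linarith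
  have "(f (s + T) - f s) * d (s + T) \<le> \<bar>f (s + T) - f s\<bar> * \<bar>d (s + T)\<bar>"
    by (metis abs_ge_self abs_mult)
  also have "\<dots> \<le> (real T * c) * c"
    using abs_diff_le_of_increments[where f = f, OF assms(1)] Suc.prems[of "s + T"] c
    by (intro mult_mono) auto
  finally have "(f (s + T) - f s) * d (s + T) \<le> real T * c\<^sup>2"
    by (simp add: power2_eq_square algebra_simps)
  moreover have "(\<Sum>t\<in>{s..<s + T}. f t * d t)
      \<le> f s * (\<Sum>t\<in>{s..<s + T}. d t) + real T * (real T - 1) / 2 * c\<^sup>2"
    by (rule Suc.IH) (use Suc.prems in auto)
  ultimately show ?case
    by (simp add: field_simps)
qed simp

theorem theorem4:
  fixes \<Omega> :: "'w set"
    and A :: "'n::finite \<Rightarrow> 'a set"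
    and u :: "'n \<Rightarrow> ('n \<Rightarrow> 'a) \<Rightarrow> 'w \<Rightarrow> real"
    and umax :: "real ^ 'n"
    and \<phi> :: "real ^ 'n \<Rightarrow> real"
    and V C :: real
    and \<omega> :: "nat \<Rightarrow> 'w"
    and b \<alpha> :: "nat \<Rightarrow> 'n \<Rightarrow> 'a"
    and Q Z \<gamma> :: "nat \<Rightarrow> real ^ 'n"
    and T K :: nat
  assumes "stochastic_game \<Omega> A u umax"
    and "concave_on (cbox 0 umax) \<phi>"
    and "continuous_on (cbox 0 umax) \<phi>"
    and "\<And>g. g \<in> cbox 0 umax \<Longrightarrow> 0 \<le> \<phi> g"
    and "C = (\<Sum>i\<in>UNIV. (umax $ i)\<^sup>2)"
    and "V > 0"
    and "\<And>t. \<omega> t \<in> \<Omega>"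
    and "\<And>t. b t \<in> profiles A"
    and "general_algorithm A u umax \<phi> V \<omega> b Q Z \<gamma> \<alpha>"
    and "Q 0 = 0"
    and "Z 0 = 0"
    and "T > 0"
    and "K > 0"
  shows "1 / real (K * T) * (\<Sum>\<tau><K * T. \<phi> (\<gamma> \<tau>))
           \<ge> 1 / real K * (\<Sum>k<K. lookahead_value A u umax \<phi> \<omega> b T k) - real T * C / V"
proof -
  define L where "L t = (\<Sum>i\<in>UNIV. (Q t $ i)\<^sup>2 + (Z t $ i)\<^sup>2) / 2" for t
  have u_bounds: "0 \<le> u i a (\<omega> t)" "u i a (\<omega> t) \<le> umax $ i" if "a \<in> profiles A" for i a t
    using assms(1,7) that unfolding stochastic_game_def by blast+
  have \<gamma>_max: "\<gamma> t \<in> cbox 0 umax"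
      "g \<in> cbox 0 umax \<Longrightarrow> V * \<phi> g - (\<Sum>i\<in>UNIV. Z t $ i * g $ i)
         \<le> V * \<phi> (\<gamma> t) - (\<Sum>i\<in>UNIV. Z t $ i * \<gamma> t $ i)"
    and \<alpha>_max: "\<alpha> t \<in> profiles A"
      "a \<in> profiles A \<Longrightarrow> (\<Sum>i\<in>UNIV. u i a (\<omega> t) * (Q t $ i + Z t $ i))
         \<le> (\<Sum>i\<in>UNIV. u i (\<alpha> t) (\<omega> t) * (Q t $ i + Z t $ i))"
    and Q_Suc: "Q (Suc t) $ i = max (Q t $ i + u i (b t) (\<omega> t) - u i (\<alpha> t) (\<omega> t)) 0"
    and Z_Suc: "Z (Suc t) $ i = Z t $ i + \<gamma> t $ i - u i (\<alpha> t) (\<omega> t)"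
    for t g a i
    using assms(9) unfolding general_algorithm_def is_arg_max_linorder by blast+
  have \<gamma>_bounds: "0 \<le> \<gamma> t $ i" "\<gamma> t $ i \<le> umax $ i" for t i
    using \<gamma>_max(1)[of t] by (simp_all add: mem_box_cart)
  have Q_nonneg: "0 \<le> Q t $ i" for t i
    by (cases t) (simp_all add: Q_Suc assms(10))
  \<comment> \<open>If the update truncates, the queue falls by \<open>Q t $ i\<close>, which is
    then at most the payoff under \<open>\<alpha> t\<close> minus the baseline payoff.\<close>
  have Q_inc: "\<bar>Q (Suc t) $ i - Q t $ i\<bar> \<le> umax $ i" for t i
    using Q_nonneg[of t i] u_bounds[OF assms(8)[of t], of i t] u_bounds[OF \<alpha>_max(1)[of t], of i t]
    unfolding Q_Suc by linarith
  have Z_inc: "\<bar>Z (Suc t) $ i - Z t $ i\<bar> \<le> umax $ i" for t i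
    using \<gamma>_bounds[of t i] u_bounds[OF \<alpha>_max(1)[of t], of i t]
    unfolding Z_Suc by linarith

  have slot: "L (Suc t) - L t - V * \<phi> (\<gamma> t) \<le> C - V * \<phi> g
      + (\<Sum>i\<in>UNIV. Q t $ i * (u i (b t) (\<omega> t) - u i a (\<omega> t)) + Z t $ i * (g $ i - u i a (\<omega> t)))"
    if "g \<in> cbox 0 umax" "a \<in> profiles A" for t g a
  proof -
    have "L (Suc t) - L t
        = (\<Sum>i\<in>UNIV. ((Q (Suc t) $ i)\<^sup>2 + (Z (Suc t) $ i)\<^sup>2) / 2 - ((Q t $ i)\<^sup>2 + (Z t $ i)\<^sup>2) / 2)"
      by (simp add: L_def sum_subtractf sum_divide_distrib)
    also have "\<dots> \<le> (\<Sum>i\<in>UNIV. (umax $ i)\<^sup>2 + Q t $ i * (u i (b t) (\<omega> t) - u i (\<alpha> t) (\<omega> t))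
        + Z t $ i * (\<gamma> t $ i - u i (\<alpha> t) (\<omega> t)))"
      unfolding Q_Suc Z_Suc
      by (intro sum_mono quadratic_drift_le u_bounds \<gamma>_bounds \<alpha>_max(1) assms(8))
    \<comment> \<open>The choice of \<open>\<gamma> t\<close> minimizes the terms in
      \<open>\<gamma>\<close>, namely \<open>Z\<close> times \<open>\<gamma>\<close> minus
      \<open>V * \<phi>\<close>. Collecting the payoffs of \<open>\<alpha> t\<close> gives minus the
      objective that \<open>\<alpha> t\<close> maximizes. Each can thus be exchanged for its
      competitor, while the baseline terms stay put.\<close>
    finally show ?thesis
      using \<gamma>_max(2)[OF that(1), of t] \<alpha>_max(2)[OF that(2), of t]
      by (simp add: assms(5) sum.distrib sum_subtractf algebra_simps)
  qed

  have frame: "V * real T * \<phi> g \<le> L (k * T) - L (k * T + T)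
      + V * (\<Sum>\<tau>\<in>{k * T..<k * T + T}. \<phi> (\<gamma> \<tau>)) + (real T)\<^sup>2 * C"
    if feasible: "lookahead_feasible A u umax \<omega> b T k g a" for k g a
  proof -
    define F where "F = {k * T..<k * T + T}"
    have F_eq: "{k * T..<(k + 1) * T} = F"
      by (simp add: F_def add.commute)
    have a: "a \<tau> \<in> profiles A" if "\<tau> \<in> F" for \<tau>
      using feasible that unfolding lookahead_feasible_def F_eq by blast+
    have g_box: "g \<in> cbox 0 umax"
      and g_eq: "real T * g $ i = (\<Sum>\<tau>\<in>F. u i (a \<tau>) (\<omega> \<tau>))"
      and g_ge: "(\<Sum>\<tau>\<in>F. u i (b \<tau>) (\<omega> \<tau>)) \<le> real T * g $ i" for i
      using feasible \<open>T > 0\<close> unfolding lookahead_feasible_def F_eq by (auto simp: field_simps)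
    have g_bounds: "0 \<le> g $ i" "g $ i \<le> umax $ i" for i
      using g_box by (simp_all add: mem_box_cart)
    \<comment> \<open>The price of freezing one queue of player \<open>i\<close>; it is paid once
      for \<open>Q\<close> and once for \<open>Z\<close>.\<close>
    let ?e = "\<lambda>i. real T * (real T - 1) / 2 * (umax $ i)\<^sup>2"
    have Q_cross: "(\<Sum>\<tau>\<in>F. Q \<tau> $ i * (u i (b \<tau>) (\<omega> \<tau>) - u i (a \<tau>) (\<omega> \<tau>))) \<le> ?e i" for i
    proof -
      have "(\<Sum>\<tau>\<in>F. Q \<tau> $ i * (u i (b \<tau>) (\<omega> \<tau>) - u i (a \<tau>) (\<omega> \<tau>)))
          \<le> Q (k * T) $ i * (\<Sum>\<tau>\<in>F. u i (b \<tau>) (\<omega> \<tau>) - u i (a \<tau>) (\<omega> \<tau>)) + ?e i"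
        unfolding F_def
      proof (rule sum_mult_le_frozen[where f = "\<lambda>t. Q t $ i", OF Q_inc])
        fix \<tau> assume "\<tau> \<in> {k * T..<k * T + T}"
        then show "\<bar>u i (b \<tau>) (\<omega> \<tau>) - u i (a \<tau>) (\<omega> \<tau>)\<bar> \<le> umax $ i"
          using u_bounds[OF assms(8)[of \<tau>], of i \<tau>] u_bounds[OF a[of \<tau>], of i \<tau>]
          by (simp add: F_def)
      qed
      moreover have "Q (k * T) $ i * (\<Sum>\<tau>\<in>F. u i (b \<tau>) (\<omega> \<tau>) - u i (a \<tau>) (\<omega> \<tau>)) \<le> 0"
        using g_eq[of i] g_ge[of i] Q_nonneg[of "k * T" i]
        by (intro mult_nonneg_nonpos) (simp_all add: sum_subtractf)
      ultimately show ?thesis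
        by linarith
    qed
    have Z_cross: "(\<Sum>\<tau>\<in>F. Z \<tau> $ i * (g $ i - u i (a \<tau>) (\<omega> \<tau>))) \<le> ?e i" for i
    proof -
      have "(\<Sum>\<tau>\<in>F. Z \<tau> $ i * (g $ i - u i (a \<tau>) (\<omega> \<tau>)))
          \<le> Z (k * T) $ i * (\<Sum>\<tau>\<in>F. g $ i - u i (a \<tau>) (\<omega> \<tau>)) + ?e i"
        unfolding F_def
      proof (rule sum_mult_le_frozen[where f = "\<lambda>t. Z t $ i", OF Z_inc])
        fix \<tau> assume "\<tau> \<in> {k * T..<k * T + T}"
        then show "\<bar>g $ i - u i (a \<tau>) (\<omega> \<tau>)\<bar> \<le> umax $ i"
          using g_bounds[of i] u_bounds[OF a[of \<tau>], of i \<tau>]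
          by (simp add: F_def)
      qed
      moreover have "(\<Sum>\<tau>\<in>F. g $ i - u i (a \<tau>) (\<omega> \<tau>)) = 0"
        using g_eq[of i] by (simp add: sum_subtractf F_def)
      ultimately show ?thesis
        by simp
    qed
    have "(\<Sum>\<tau>\<in>F. L (Suc \<tau>) - L \<tau>) = L (k * T + T) - L (k * T)"
      by (simp add: F_def sum_Suc_diff')
    then have "L (k * T + T) - L (k * T) - V * (\<Sum>\<tau>\<in>F. \<phi> (\<gamma> \<tau>))
        = (\<Sum>\<tau>\<in>F. L (Suc \<tau>) - L \<tau> - V * \<phi> (\<gamma> \<tau>))"
      by (simp only: sum_subtractf sum_distrib_left)
    also have "\<dots> \<le> (\<Sum>\<tau>\<in>F. C - V * \<phi> g
      + (\<Sum>i\<in>UNIV. Q \<tau> $ i * (u i (b \<tau>) (\<omega> \<tau>) - u i (a \<tau>) (\<omega> \<tau>)) + Z \<tau> $ i * (g $ i - u i (a \<tau>) (\<omega> \<tau>))))"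
      by (intro sum_mono slot g_box a)
    also have "\<dots> = real T * (C - V * \<phi> g)
      + (\<Sum>i\<in>UNIV. (\<Sum>\<tau>\<in>F. Q \<tau> $ i * (u i (b \<tau>) (\<omega> \<tau>) - u i (a \<tau>) (\<omega> \<tau>)))
          + (\<Sum>\<tau>\<in>F. Z \<tau> $ i * (g $ i - u i (a \<tau>) (\<omega> \<tau>))))"
      by (subst sum.distrib, subst sum.swap) (simp add: sum.distrib F_def)
    also have "\<dots> \<le> real T * (C - V * \<phi> g) + (\<Sum>i\<in>UNIV. ?e i + ?e i)"
      by (intro add_left_mono sum_mono add_mono Q_cross Z_cross)
    also have "(\<Sum>i\<in>UNIV. ?e i + ?e i) = real T * (real T - 1) * C"
      unfolding assms(5) sum_distrib_left by (intro sum.cong) auto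
    finally show ?thesis
      unfolding F_def by (simp add: algebra_simps power2_eq_square)
  qed

  have frame_value: "V * real T * lookahead_value A u umax \<phi> \<omega> b T k \<le> L (k * T) - L (k * T + T)
      + V * (\<Sum>\<tau>\<in>{k * T..<k * T + T}. \<phi> (\<gamma> \<tau>)) + (real T)\<^sup>2 * C" (is "_ \<le> ?R") for k
  proof -
    have VT: "0 < V * real T"
      using \<open>V > 0\<close> \<open>T > 0\<close> by simp
    \<comment> \<open>Playing the baseline itself is feasible, with \<open>g\<close> its average
      payoff; this gives the nonemptiness needed to pass from \<open>frame\<close> to the
      supremum.\<close>
    define g :: "real ^ 'n"
      where "g = (\<chi> i. 1 / real T * (\<Sum>\<tau>\<in>{k * T..<(k + 1) * T}. u i (b \<tau>) (\<omega> \<tau>)))"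
    have "(\<Sum>\<tau>\<in>{k * T..<(k + 1) * T}. u i (b \<tau>) (\<omega> \<tau>)) \<le> real T * umax $ i" for i
      using sum_bounded_above[of "{k * T..<(k + 1) * T}" "\<lambda>\<tau>. u i (b \<tau>) (\<omega> \<tau>)" "umax $ i"]
        u_bounds(2)[OF assms(8)] by simp
    then have "g \<in> cbox 0 umax"
      using \<open>T > 0\<close> by (auto simp: g_def mem_box_cart field_simps intro!: sum_nonneg u_bounds assms(8))
    then have "lookahead_feasible A u umax \<omega> b T k g b"
      by (simp add: lookahead_feasible_def g_def assms(8))
    then have "lookahead_value A u umax \<phi> \<omega> b T k \<le> ?R / (V * real T)"
      unfolding lookahead_value_def
      by (intro cSup_least) (use frame VT in \<open>auto simp: pos_le_divide_eq mult.commute[of _ "V * real T"]\<close>)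
    then show ?thesis
      using VT by (simp add: pos_le_divide_eq mult.commute[of _ "V * real T"])
  qed

  have "V * real T * (\<Sum>k<K. lookahead_value A u umax \<phi> \<omega> b T k)
      \<le> (\<Sum>k<K. L (k * T) - L (k * T + T)
          + V * (\<Sum>\<tau>\<in>{k * T..<k * T + T}. \<phi> (\<gamma> \<tau>)) + (real T)\<^sup>2 * C)"
    by (subst sum_distrib_left) (intro sum_mono frame_value)
  also have "\<dots> = L 0 - L (K * T) + V * (\<Sum>\<tau><K * T. \<phi> (\<gamma> \<tau>)) + real K * (real T)\<^sup>2 * C"
  proof -
    have "(\<Sum>k<K. L (k * T) - L (k * T + T)) = L 0 - L (K * T)"
      using sum_lessThan_telescope'[of "\<lambda>k. L (k * T)" K] by (simp add: add.commute)
    \<comment> \<open>The \<open>K\<close> consecutive frames tile the rounds below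
      \<open>K * T\<close>.\<close>
    moreover have "(\<Sum>k<K. V * (\<Sum>\<tau>\<in>{k * T..<k * T + T}. \<phi> (\<gamma> \<tau>))) = V * (\<Sum>\<tau><K * T. \<phi> (\<gamma> \<tau>))"
      by (simp only: sum.nat_group flip: sum_distrib_left)
    ultimately show ?thesis
      by (simp only: sum.distrib) simp
  qed
  also have "L 0 = 0"
    by (simp add: L_def assms(10,11))
  also have "0 - L (K * T) \<le> 0"
    by (simp add: L_def sum_nonneg)
  \<comment> \<open>Normalizing by \<open>V K T\<close> turns the total error
    \<open>K T\<^sup>2 C\<close> into \<open>T C / V\<close>.\<close>
  finally have "V * real T * (\<Sum>k<K. lookahead_value A u umax \<phi> \<omega> b T k) / (V * real K * real T)
      \<le> (V * (\<Sum>\<tau><K * T. \<phi> (\<gamma> \<tau>)) + real K * (real T)\<^sup>2 * C) / (V * real K * real T)"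
    using \<open>V > 0\<close> by (intro divide_right_mono) simp_all
  then show ?thesis
    using \<open>V > 0\<close> \<open>T > 0\<close> \<open>K > 0\<close> by (simp add: add_divide_distrib power2_eq_square algebra_simps)
qed

end
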